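(* Let $G=(V,E)$ be an undirected, simple, connected graph with $n$ vertices and maximum degree $\Delta(G)=k$. Then $\mathrm{rad}(B_{n,k})\leq \mathrm{rad}(G)\leq \mathrm{rad}(S_{n,k})$. In particular: (i) If $G$ contains a $k$-balanced tree $B_{n,k}$ (as a subgraph), then $\mathrm{rad}(G)=\mathrm{rad}(B_{n,k})$. (ii) If $\mathrm{rad}(G)=\mathrm{rad}(S_{n,k})$, then $G$ contains a tree $C^{\star}_{n,k}$ (as a subgraph).
   Context: $\mathrm{dist}(u,v)$ is the number of edges of a shortest $u$–$v$ path; the length of a path is its number of edges. The eccentricity is $\mathrm{ecc}(x)=\max_y\mathrm{dist}(x,y)$ and $\mathrm{rad}(G)=\min_x\mathrm{ecc}(x)$. A tree $T$ of maximum degree $k$ is $k$-balanced if there exists a vertex $x$ such that every vertex $z$ with $\mathrm{dist}(z,x)\le \mathrm{ecc}(x)-2$ has $\deg(z)=k$; $B_{n,k}$ denotes an arbitrary $k$-balanced tree of order $n$ (its radius depends only on $n,k$). For $n\ge3$, $k\ge2$, a tree of order $n$ with maximum degree $k$ is a $k$-comet $C_{n,k}$ if some vertex $v$ of degree $k$ lies on a path of length $n-k+1$; $S_{n,k}$ is the $k$-comet in which $k-1$ neighbours of $v$ are leaves (uniquely determined). A $C^{\star}_{n,k}$ is a tree of order $n$ and maximum degree $k$ containing some $C_{n-1,k}$ as a subtree.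
   Formalization: Part (ii) is stated only for n ≥ k+2: for n = k+1 no tree C*_{n,k} exists (it would contain a tree on k vertices with a vertex of degree k), so (ii) fails there, e.g. for the star K_{1,k} with k ≥ 2, whose radius is 1 = rad(S_{n,k}). *)

theory Defs
  imports "Graph_Theory.Graph_Theory"
begin

text \<open>
  A finite simple undirected graph is an element of the locale \<^locale>\<open>graph\<close>: a finite, loop-free
  symmetric digraph without parallel arcs. An undirected edge is thus a pair of opposite arcs, so
  \<^const>\<open>out_degree\<close> is the degree of a vertex and the number of arcs of a path is its length.
\<close>

definition max_degree :: "('a,'b) pre_digraph \<Rightarrow> nat" where
  "max_degree G = Max (out_degree G ` verts G)"

text \<open>Only meaningful if \<open>u\<close> and \<open>v\<close> are joined by a path, in particular in connected graphs.\<close>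

definition gdist :: "('a,'b) pre_digraph \<Rightarrow> 'a \<Rightarrow> 'a \<Rightarrow> nat" where
  "gdist G u v = (LEAST l. \<exists>p. pre_digraph.apath G u p v \<and> length p = l)"

definition ecc :: "('a,'b) pre_digraph \<Rightarrow> 'a \<Rightarrow> nat" where
  "ecc G x = Max (gdist G x ` verts G)"

definition rad :: "('a,'b) pre_digraph \<Rightarrow> nat" where
  "rad G = Min (ecc G ` verts G)"

text \<open>
  \<^const>\<open>tree\<close> is unsuitable here: it forbids directed cycles, and in a symmetric digraph every edge
  yields a directed cycle of length 2. The cycles of the undirected graph are those of length at
  least 3.
\<close>

definition undirected_tree :: "('a,'b) pre_digraph \<Rightarrow> bool" where
  "undirected_tree T \<longleftrightarrow>
     graph T \<and> connected T \<and> \<not> (\<exists>p. pre_digraph.cycle T p \<and> 3 \<le> length p)"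

definition tree_order_maxdeg :: "nat \<Rightarrow> nat \<Rightarrow> ('a,'b) pre_digraph \<Rightarrow> bool" where
  "tree_order_maxdeg n k T \<longleftrightarrow>
     undirected_tree T \<and> card (verts T) = n \<and> max_degree T = k"

text \<open>
  The condition \<open>dist z x \<le> ecc x - 2\<close> is written with an addition because subtraction on
  \<^typ>\<open>nat\<close> truncates: for \<open>ecc x < 2\<close> no vertex is constrained.
\<close>

definition balanced_tree :: "nat \<Rightarrow> nat \<Rightarrow> ('a,'b) pre_digraph \<Rightarrow> bool" where
  "balanced_tree n k T \<longleftrightarrow>
     tree_order_maxdeg n k T \<and>
     (\<exists>x\<in>verts T. \<forall>z\<in>verts T. gdist T z x + 2 \<le> ecc T x \<longrightarrow> out_degree T z = k)"

definition comet_center :: "nat \<Rightarrow> nat \<Rightarrow> ('a,'b) pre_digraph \<Rightarrow> 'a \<Rightarrow> bool" where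
  "comet_center n k T v \<longleftrightarrow>
     v \<in> verts T \<and> out_degree T v = k \<and>
     (\<exists>a p b. pre_digraph.apath T a p b \<and> length p = n - k + 1 \<and>
        v \<in> set (pre_digraph.awalk_verts T a p))"

definition comet :: "nat \<Rightarrow> nat \<Rightarrow> ('a,'b) pre_digraph \<Rightarrow> bool" where
  "comet n k T \<longleftrightarrow>
     3 \<le> n \<and> 2 \<le> k \<and> tree_order_maxdeg n k T \<and> (\<exists>v. comet_center n k T v)"

text \<open>
  At least \<open>k - 1\<close> of the neighbours are leaves; all \<open>k\<close> of them are exactly if
  \<open>n = k + 1\<close>, where the tree is a star.
\<close>

definition short_comet :: "nat \<Rightarrow> nat \<Rightarrow> ('a,'b) pre_digraph \<Rightarrow> bool" where
  "short_comet n k T \<longleftrightarrow>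
     3 \<le> n \<and> 2 \<le> k \<and> tree_order_maxdeg n k T \<and>
     (\<exists>v. comet_center n k T v \<and>
        k - 1 \<le> card {w \<in> verts T. v \<rightarrow>\<^bsub>T\<^esub> w \<and> out_degree T w = 1})"

definition comet_star :: "nat \<Rightarrow> nat \<Rightarrow> ('a,'b) pre_digraph \<Rightarrow> bool" where
  "comet_star n k T \<longleftrightarrow>
     tree_order_maxdeg n k T \<and> (\<exists>C. subgraph C T \<and> comet (n - 1) k C)"

end

theory Submission
  imports Defs
begin

text \<open>
  Lower bound: the layers around a vertex of \<open>G\<close> grow by a factor of at most \<open>k\<close> in the first step
  and at most \<open>k - 1\<close> afterwards, while around the distinguished vertex of a balanced tree all layers
  but the last one attain this growth. So a vertex of smaller eccentricity would see too few vertices.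
  Applied to two balanced trees, this also shows that they have the same radius, whence (i).

  Upper bound: take a breadth-first search tree rooted at a vertex \<open>v\<close> of degree \<open>k\<close>, a deepest
  vertex \<open>a\<close>, and let \<open>m\<close> bound the lengths of the paths from \<open>a\<close> through \<open>v\<close> into another branch.
  Counting the vertices on a branch to \<open>a\<close>, on a path attached to it and next to \<open>v\<close> shows that
  \<open>m = n - k + 1\<close> is possible, and that the vertex at distance \<open>r = \<lceil>m/2\<rceil>\<close> from \<open>a\<close> on its branch (or \<open>v\<close>,
  if all depths are at most \<open>r\<close>) has eccentricity at most \<open>r\<close> as soon as \<open>m \<ge> n - k - 1\<close>. On the other
  hand \<open>S\<close> is a tree with a path of length \<open>n - k + 1\<close>, and paths in trees are geodesics. In the
  equality case \<open>m = n - k - 1\<close> must be impossible, so the search tree has a path of length \<open>n - k\<close> with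
  \<open>v\<close> in its interior; together with the neighbours of \<open>v\<close> it forms a comet on \<open>n - 1\<close> vertices.
\<close>

subsection \<open>Neighbourhoods and distances\<close>

definition nbrs :: "('a,'b) pre_digraph \<Rightarrow> 'a \<Rightarrow> 'a set" where
  "nbrs G u = {w. u \<rightarrow>\<^bsub>G\<^esub> w}"

lemma (in wf_digraph) nbrs_subset: "nbrs G u \<subseteq> verts G"
  by (auto simp: nbrs_def dest: adj_in_verts)

lemma (in fin_digraph) finite_nbrs [simp]: "finite (nbrs G u)"
  using nbrs_subset finite_verts by (rule finite_subset)

text \<open>Without parallel arcs an outgoing arc is determined by its head, so degrees can be
  handled as sizes of vertex sets.\<close>

lemma (in nomulti_digraph) card_nbrs: "card (nbrs G u) = out_degree G u"
proof -
  have "inj_on (head G) (out_arcs G u)"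
    by (rule inj_onI) (auto intro: no_multi_arcs simp: arc_to_ends_def)
  moreover have "nbrs G u = head G ` out_arcs G u"
    by (auto simp: nbrs_def arcs_ends_conv)
  ultimately show ?thesis
    by (simp add: out_degree_def card_image)
qed

lemma (in fin_digraph) out_degree_le_max_degree:
  "u \<in> verts G \<Longrightarrow> out_degree G u \<le> max_degree G"
  unfolding max_degree_def by (rule Max_ge) auto

lemma (in fin_digraph) max_degree_eqI:
  assumes "v \<in> verts G" "out_degree G v = k" "\<And>u. u \<in> verts G \<Longrightarrow> out_degree G u \<le> k"
  shows "max_degree G = k"
  unfolding max_degree_def using assms by (intro Max_eqI) auto

lemma (in fin_digraph) subgraph_out_degree:
  assumes "subgraph H G"
  shows "out_degree H v \<le> out_degree G v"
  unfolding out_degree_def using assms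
  by (intro card_mono) (auto simp: subgraph_def compatible_head compatible_tail)

context sym_digraph
begin

lemma connected_conv: "connected G \<longleftrightarrow> strongly_connected G"
  unfolding connected_def strongly_connected_def
  using reachable_mk_symmetric_eq[OF sym_arcs] by simp

text \<open>Each arc is replaced by an opposite one. The vertex set is recorded because a path is
  later assembled from two walks to the root, one of them reversed.\<close>

lemma awalk_reverse:
  assumes "awalk u p v"
  obtains q where "awalk v q u" "length q = length p"
    "set (awalk_verts v q) = set (awalk_verts u p)"
  using assms
proof (induction p arbitrary: u thesis)
  case Nil
  then show ?case
    by (metis awalk_Nil_iff)
next
  case (Cons e es)
  from Cons.prems(2) have e: "e \<in> arcs G" "u = tail G e" and es: "awalk (head G e) es v"
    by (auto simp: awalk_Cons_iff)
  obtain q where q: "awalk v q (head G e)" "length q = length es"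
    "set (awalk_verts v q) = set (awalk_verts (head G e) es)"
    using Cons.IH es by blast
  obtain f where f: "f \<in> arcs G" "tail G f = head G e" "head G f = tail G e"
    using sym_arcs e(1) unfolding symmetric_conv by metis
  have "awalk (head G e) [f] u"
    using f e by (auto simp: awalk_simps)
  with q have w: "awalk v (q @ [f]) u"
    by (auto intro: awalk_appendI)
  moreover have "head G e \<in> set (awalk_verts (head G e) es)"
    using es by (rule hd_in_awalk_verts)
  moreover have "awalk_verts v (q @ [f]) = awalk_verts v q @ [u]"
    using w q(1) f e by (simp add: awalk_verts_append)
  ultimately show ?case
    using q e by (intro Cons.prems(1)[of "q @ [f]"]) auto
qed

end

text \<open>\<open>gdist\<close> minimises over paths only, so the walk is first reduced to a path;
  the arcs of that path are distinct and all occur in the walk.\<close>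

lemma (in wf_digraph) gdist_le_awalk:
  assumes "awalk u p v"
  shows "gdist G u v \<le> length p"
proof -
  let ?q = "awalk_to_apath p"
  have q: "apath u ?q v"
    using assms by (rule apath_awalk_to_apath)
  then have "distinct ?q"
    by (auto simp: apath_def intro: distinct_verts_imp_distinct)
  then have "length ?q = card (set ?q)"
    by (simp add: distinct_card)
  also have "\<dots> \<le> card (set p)"
    using awalk_to_apath_subset[OF assms] by (simp add: card_mono)
  also have "\<dots> \<le> length p"
    by (rule card_length)
  finally have "length ?q \<le> length p" .
  moreover have "gdist G u v \<le> length ?q"
    unfolding gdist_def using q by (intro Least_le) blast
  ultimately show ?thesis by simp
qed

section \<open>Geodesics, eccentricity and radius\<close>

locale connected_graph = graph +
  assumes connected: "connected G"
begin

lemma verts_nonempty: "verts G \<noteq> {}"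
  using connected unfolding connected_conv strongly_connected_def by simp

lemma obtain_geodesic:
  assumes "u \<in> verts G" "v \<in> verts G"
  obtains p where "apath u p v" "length p = gdist G u v"
proof -
  have "u \<rightarrow>\<^sup>* v"
    using assms connected unfolding connected_conv strongly_connected_def by simp
  then obtain p where "apath u p v"
    unfolding reachable_apath by blast
  then have "\<exists>l p. apath u p v \<and> length p = l"
    by blast
  then have "\<exists>p. apath u p v \<and> length p = gdist G u v"
    unfolding gdist_def by (rule LeastI_ex)
  then show ?thesis
    using that by blast
qed

lemma gdist_eq_0_iff:
  assumes "u \<in> verts G" "v \<in> verts G"
  shows "gdist G u v = 0 \<longleftrightarrow> u = v"
proof
  assume "gdist G u v = 0"
  then show "u = v"
    using obtain_geodesic[OF assms] by (metis apath_Nil_iff length_0_conv)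
next
  assume "u = v"
  then show "gdist G u v = 0"
    using gdist_le_awalk[of u "[]" v] assms by (simp add: awalk_Nil_iff)
qed

lemma gdist_self [simp]: "u \<in> verts G \<Longrightarrow> gdist G u u = 0"
  by (simp add: gdist_eq_0_iff)

lemma gdist_triangle:
  assumes "u \<in> verts G" "v \<in> verts G" "w \<in> verts G"
  shows "gdist G u w \<le> gdist G u v + gdist G v w"
proof -
  obtain p where p: "apath u p v" "length p = gdist G u v"
    using obtain_geodesic assms by blast
  obtain q where q: "apath v q w" "length q = gdist G v w"
    using obtain_geodesic assms by blast
  have "awalk u (p @ q) w"
    using awalk_appendI[OF awalkI_apath awalkI_apath] p q by blast
  from gdist_le_awalk[OF this] show ?thesis
    using p q by simp
qed

lemma gdist_sym:
  assumes "u \<in> verts G" "v \<in> verts G"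
  shows "gdist G u v = gdist G v u"
proof -
  have "gdist G u v \<le> gdist G v u" if uv: "u \<in> verts G" "v \<in> verts G" for u v
  proof -
    obtain p where p: "apath v p u" "length p = gdist G v u"
      using obtain_geodesic uv by blast
    then obtain q where "awalk u q v" "length q = length p"
      using awalk_reverse awalkI_apath by metis
    with p show ?thesis
      by (metis gdist_le_awalk)
  qed
  with assms show ?thesis
    by (metis le_antisym)
qed

lemma gdist_adj_le: "u \<rightarrow> v \<Longrightarrow> gdist G u v \<le> 1"
  using gdist_le_awalk[OF arc_implies_awalk] by auto

lemma gdist_adj_le_Suc:
  assumes "x \<in> verts G" "u \<rightarrow> v"
  shows "gdist G x v \<le> Suc (gdist G x u)"
  using gdist_triangle[of x u v] gdist_adj_le[OF assms(2)] assms adj_in_verts by fastforce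

text \<open>The last arc of a geodesic starts at such a \<open>u\<close>. These predecessors drive
  the layer counts and later serve as parents in the search tree.\<close>

lemma gdist_predecessor:
  assumes "x \<in> verts G" "v \<in> verts G" "x \<noteq> v"
  obtains u where "u \<rightarrow> v" "gdist G x v = Suc (gdist G x u)"
proof -
  obtain p where p: "apath x p v" "length p = gdist G x v"
    using obtain_geodesic assms by blast
  then have "p \<noteq> []"
    using assms by (auto simp: apath_Nil_iff)
  then obtain q e where pe: "p = q @ [e]"
    by (metis rev_exhaust)
  with p have w: "awalk x q (tail G e)" "e \<in> arcs G" "head G e = v"
    by (auto simp: apath_def awalk_simps)
  then have adj: "tail G e \<rightarrow> v"
    using in_arcs_imp_in_arcs_ends by blast
  moreover have "gdist G x (tail G e) \<le> length q"
    using w(1) by (rule gdist_le_awalk)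
  then have "gdist G x v = Suc (gdist G x (tail G e))"
    using gdist_adj_le_Suc[OF assms(1) adj] p(2) pe by simp
  ultimately show ?thesis
    by (rule that)
qed

lemma gdist_le_ecc: "y \<in> verts G \<Longrightarrow> gdist G x y \<le> ecc G x"
  unfolding ecc_def by (intro Max_ge) auto

lemma ecc_le_iff: "ecc G x \<le> r \<longleftrightarrow> (\<forall>y\<in>verts G. gdist G x y \<le> r)"
  unfolding ecc_def using verts_nonempty by (subst Max_le_iff) auto

lemma obtain_farthest:
  obtains y where "y \<in> verts G" "gdist G x y = ecc G x"
proof -
  have "ecc G x \<in> gdist G x ` verts G"
    unfolding ecc_def using verts_nonempty by (intro Max_in) auto
  then show ?thesis
    using that by force
qed

lemma rad_le_ecc: "x \<in> verts G \<Longrightarrow> rad G \<le> ecc G x"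
  unfolding rad_def by (intro Min_le) auto

lemma obtain_center:
  obtains x where "x \<in> verts G" "ecc G x = rad G"
proof -
  have "rad G \<in> ecc G ` verts G"
    unfolding rad_def using verts_nonempty by (intro Min_in) auto
  then show ?thesis
    using that by force
qed

lemma gdist_le_two_rad:
  assumes "u \<in> verts G" "v \<in> verts G"
  shows "gdist G u v \<le> 2 * rad G"
proof -
  obtain x where x: "x \<in> verts G" "ecc G x = rad G"
    by (rule obtain_center)
  then show ?thesis
    using gdist_triangle[of u x v] gdist_sym[of u x] gdist_le_ecc[of u x] gdist_le_ecc[of v x] assms
    by simp
qed

text \<open>Extra arcs cannot lengthen distances, so a centre of \<open>H\<close> has eccentricity
  at most \<open>rad H\<close> in \<open>G\<close>.\<close>

lemma rad_spanning_le:
  assumes sub: "subgraph H G" and "verts H = verts G" and "connected_graph H"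
  shows "rad G \<le> rad H"
proof -
  interpret H: connected_graph H by fact
  obtain x where x: "x \<in> verts H" "ecc H x = rad H"
    by (rule H.obtain_center)
  have "gdist G x y \<le> rad H" if y: "y \<in> verts G" for y
  proof -
    obtain p where p: "H.apath x p y" "length p = gdist H x y"
      using H.obtain_geodesic x(1) y assms(2) by metis
    then have "gdist G x y \<le> gdist H x y"
      using subgraph_awalk_imp_awalk[OF _ sub] gdist_le_awalk H.awalkI_apath by metis
    also have "\<dots> \<le> rad H"
      using H.gdist_le_ecc[of y x] y x assms(2) by simp
    finally show ?thesis .
  qed
  then show ?thesis
    using rad_le_ecc[of x] ecc_le_iff[of x "rad H"] x(1) assms(2) by fastforce
qed

subsection \<open>Layers around a vertex\<close>

definition sphere :: "'a \<Rightarrow> nat \<Rightarrow> 'a set" where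
  "sphere x i = {y \<in> verts G. gdist G x y = i}"

lemma finite_sphere [simp]: "finite (sphere x i)"
  by (simp add: sphere_def)

lemma sphere_0: "x \<in> verts G \<Longrightarrow> sphere x 0 = {x}"
  by (auto simp: sphere_def gdist_eq_0_iff)

lemma card_verts_le_spheres:
  assumes "ecc G x \<le> r"
  shows "card (verts G) \<le> (\<Sum>i\<le>r. card (sphere x i))"
proof -
  have "verts G \<subseteq> (\<Union>i\<le>r. sphere x i)"
    using assms by (auto simp: ecc_le_iff sphere_def)
  then have "card (verts G) \<le> card (\<Union>i\<le>r. sphere x i)"
    by (intro card_mono) auto
  also have "\<dots> \<le> (\<Sum>i\<le>r. card (sphere x i))"
    by (rule card_UN_le) simp
  finally show ?thesis .
qed

lemma spheres_le_card_verts: "(\<Sum>i\<le>r. card (sphere x i)) \<le> card (verts G)"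
proof -
  have "(\<Sum>i\<le>r. card (sphere x i)) = card (\<Union>i\<le>r. sphere x i)"
    by (rule card_UN_disjoint[symmetric]) (auto simp: sphere_def)
  also have "\<dots> \<le> card (verts G)"
    by (intro card_mono) (auto simp: sphere_def)
  finally show ?thesis .
qed

lemma sphere_Suc:
  assumes "x \<in> verts G"
  shows "sphere x (Suc i) = (\<Union>z\<in>sphere x i. nbrs G z \<inter> sphere x (Suc i))"
proof -
  have "\<exists>z\<in>sphere x i. y \<in> nbrs G z" if "y \<in> sphere x (Suc i)" for y
  proof -
    from that have y: "y \<in> verts G" "gdist G x y = Suc i"
      by (auto simp: sphere_def)
    then have "x \<noteq> y"
      by auto
    then obtain u where "u \<rightarrow> y" "gdist G x y = Suc (gdist G x u)"
      using gdist_predecessor assms y by blast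
    then show ?thesis
      using y adj_in_verts by (auto simp: sphere_def nbrs_def)
  qed
  then show ?thesis
    by blast
qed

text \<open>Bounds the number of neighbours that a vertex of layer \<open>i\<close> has in layer
  \<open>i + 1\<close>: beyond layer 0, one neighbour is the predecessor towards the centre of the
  layers.\<close>

definition branching :: "nat \<Rightarrow> nat" where
  "branching i = (if i = 0 then max_degree G else max_degree G - 1)"

lemma card_nbrs_sphere_le:
  assumes x: "x \<in> verts G" and z: "z \<in> sphere x i"
  shows "card (nbrs G z \<inter> sphere x (Suc i)) \<le> branching i"
proof -
  have zv: "z \<in> verts G" "gdist G x z = i"
    using z by (auto simp: sphere_def)
  then have deg: "card (nbrs G z) \<le> max_degree G"
    using out_degree_le_max_degree card_nbrs by simp
  show ?thesis
  proof (cases "i = 0")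
    case True
    have "card (nbrs G z \<inter> sphere x (Suc i)) \<le> card (nbrs G z)"
      by (intro card_mono) auto
    with True deg show ?thesis
      by (simp add: branching_def)
  next
    case False
    then have "x \<noteq> z"
      using zv by auto
    then obtain u where u: "u \<rightarrow> z" "gdist G x z = Suc (gdist G x u)"
      using gdist_predecessor x zv by blast
    then have "u \<in> nbrs G z"
      using graph_symmetric by (simp add: nbrs_def)
    moreover have "u \<notin> sphere x (Suc i)"
      using u zv by (simp add: sphere_def)
    ultimately have "card (nbrs G z \<inter> sphere x (Suc i)) \<le> card (nbrs G z - {u})"
      by (intro card_mono) auto
    also have "\<dots> = card (nbrs G z) - 1"
      using \<open>u \<in> nbrs G z\<close> by simp
    finally show ?thesis
      using False deg by (simp add: branching_def)
  qed
qed

lemma card_sphere_Suc_le: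
  assumes "x \<in> verts G"
  shows "card (sphere x (Suc i)) \<le> card (sphere x i) * branching i"
proof -
  have "card (sphere x (Suc i)) = card (\<Union>z\<in>sphere x i. nbrs G z \<inter> sphere x (Suc i))"
    using sphere_Suc[OF assms] by simp
  also have "\<dots> \<le> (\<Sum>z\<in>sphere x i. card (nbrs G z \<inter> sphere x (Suc i)))"
    by (rule card_UN_le) simp
  also have "\<dots> \<le> (\<Sum>z\<in>sphere x i. branching i)"
    using card_nbrs_sphere_le[OF assms] by (rule sum_mono)
  finally show ?thesis
    by simp
qed

end

subsection \<open>Distances in trees\<close>

locale tree_graph = connected_graph +
  assumes acyclic: "cycle p \<Longrightarrow> length p < 3"
begin

text \<open>Predecessors are followed back from \<open>u\<close> to \<open>x\<close>. They are
  strictly closer to \<open>x\<close> than \<open>u\<close>, hence than \<open>w\<close>, so the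
  walk avoids \<open>w\<close>.\<close>

lemma reachable_del_vert:
  assumes "x \<in> verts G" "u \<in> verts G" "u \<noteq> w" "gdist G x u \<le> gdist G x w"
  shows "x \<rightarrow>\<^sup>*\<^bsub>del_vert w\<^esub> u"
  using assms(2-)
proof (induction "gdist G x u" arbitrary: u)
  case 0
  then have "x = u"
    using assms(1) by (metis gdist_eq_0_iff)
  with 0 show ?case
    using wf_digraph.reachable_refl[OF wf_digraph_del_vert] by (simp add: verts_del_vert)
next
  case (Suc i)
  then have "x \<noteq> u"
    using assms(1) by auto
  then obtain u' where u': "u' \<rightarrow> u" "gdist G x u = Suc (gdist G x u')"
    using gdist_predecessor assms(1) Suc.prems by blast
  then have "u' \<noteq> w" "u' \<in> verts G"
    using Suc.prems adj_in_verts by auto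
  then have "x \<rightarrow>\<^sup>*\<^bsub>del_vert w\<^esub> u'"
    using Suc.hyps u' Suc.prems by auto
  moreover have "u' \<rightarrow>\<^bsub>del_vert w\<^esub> u"
    using u'(1) \<open>u' \<noteq> w\<close> Suc.prems by (auto simp: arcs_ends_conv del_vert_simps)
  ultimately show ?case
    by (rule wf_digraph.reachable_adj_trans[OF wf_digraph_del_vert])
qed

text \<open>Two distinct such neighbours would be joined, via \<open>x\<close>, by a path avoiding
  \<open>w\<close>; closing it up through \<open>w\<close> gives a cycle of length at least 3. The
  weak inequalities also exclude edges inside a layer, so every neighbour of \<open>w\<close> but
  the predecessor is strictly farther from \<open>x\<close>.\<close>

lemma closer_nbr_unique:
  assumes x: "x \<in> verts G"
    and u: "u \<rightarrow> w" "gdist G x u \<le> gdist G x w"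
    and v: "v \<rightarrow> w" "gdist G x v \<le> gdist G x w"
  shows "u = v"
proof (rule ccontr)
  assume "u \<noteq> v"
  interpret D: wf_digraph "del_vert w"
    by (rule wf_digraph_del_vert)
  have sym: "symmetric (del_vert w)"
    using sym_arcs unfolding symmetric_conv by (fastforce simp: del_vert_simps)
  have "u \<noteq> w" "v \<noteq> w"
    using u v adj_not_same by blast+
  then have "x \<rightarrow>\<^sup>*\<^bsub>del_vert w\<^esub> u" "x \<rightarrow>\<^sup>*\<^bsub>del_vert w\<^esub> v"
    using reachable_del_vert[OF x] u v adj_in_verts by blast+
  then have "u \<rightarrow>\<^sup>*\<^bsub>del_vert w\<^esub> v"
    using symmetric_reachable[OF sym] D.reachable_trans by blast
  then obtain p where p: "D.apath u p v"
    unfolding D.reachable_apath by blast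
  then have "D.awalk u p v"
    by (rule D.awalkI_apath)
  then have "set (D.awalk_verts u p) \<subseteq> verts (del_vert w)"
    by blast
  then have w: "w \<notin> set (awalk_verts u p)"
    using compatible_awalk_verts[of G "del_vert w"] by (auto simp: del_vert_simps compatible_def)
  have p': "apath u p v"
    using p subgraph_del_vert by (rule subgraph_apath_imp_apath)
  with \<open>u \<noteq> v\<close> have "p \<noteq> []"
    by (auto simp: apath_Nil_iff)
  obtain e where e: "e \<in> arcs G" "tail G e = w" "head G e = u"
    using graph_symmetric[OF u(1)] by auto
  obtain f where f: "f \<in> arcs G" "tail G f = v" "head G f = w"
    using v(1) by auto
  have "awalk u p v"
    using p' by (rule awalkI_apath)
  moreover have vw: "awalk v [f] w"
    using f by (auto simp: awalk_simps)
  ultimately have uw: "awalk u (p @ [f]) w"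
    by (rule awalk_appendI)
  then have "awalk_verts u (p @ [f]) = awalk_verts u p @ [w]"
    using f \<open>awalk u p v\<close> by (simp add: awalk_verts_append)
  then have "distinct (tl (awalk_verts w (e # p @ [f])))"
    using e w p' by (simp add: apath_def)
  moreover have "awalk w (e # p @ [f]) w"
    using e uw by (simp add: awalk_Cons_iff del: awalk_append_iff)
  ultimately have "cycle (e # p @ [f])"
    unfolding cycle_def by blast
  from acyclic[OF this] \<open>p \<noteq> []\<close> show False
    by (cases p) auto
qed

text \<open>The distance from \<open>x\<close> grows with every arc of the path: otherwise the next
  vertex and the previous one would both be neighbours of the current vertex that are not farther
  from \<open>x\<close>, hence equal. The induction is strong because two prefixes of the path are
  involved.\<close>

lemma gdist_apath:
  assumes "apath x p y"
  shows "gdist G x y = length p"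
  using assms
proof (induction "length p" arbitrary: p y rule: less_induct)
  case less
  have x: "x \<in> verts G"
    using less.prems by (auto simp: apath_def)
  show ?case
  proof (cases p rule: rev_cases)
    case Nil
    with less.prems show ?thesis
      by (auto simp: apath_Nil_iff)
  next
    case (snoc q e)
    with less.prems have q: "apath x q (tail G e)" and e: "e \<in> arcs G" "head G e = y"
      and y: "y \<notin> set (awalk_verts x q)"
      by (auto simp: apath_append_iff apath_simps)
    have IH: "gdist G x (tail G e) = length q"
      using less.hyps q snoc by simp
    have adj: "tail G e \<rightarrow> y"
      using e in_arcs_imp_in_arcs_ends by blast
    have yv: "y \<in> verts G"
      using e by auto
    have "gdist G x y > length q"
    proof (cases q rule: rev_cases)
      case Nil
      then have "x \<noteq> y"
        using y by simp
      then show ?thesis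
        using Nil gdist_eq_0_iff[OF x yv] by simp
    next
      case (snoc q' e')
      with q have q': "apath x q' (tail G e')" and e': "e' \<in> arcs G" "head G e' = tail G e"
        by (auto simp: apath_append_iff apath_simps)
      have "gdist G x (tail G e') = length q'"
        using less.hyps q' snoc \<open>p = q @ [e]\<close> by simp
      moreover have "tail G e' \<rightarrow> tail G e"
        using e' in_arcs_imp_in_arcs_ends by metis
      moreover have "tail G e' \<in> set (awalk_verts x q)"
        using snoc by (simp add: awalk_verts_arc1)
      ultimately show ?thesis
        using closer_nbr_unique[OF x, of "tail G e'" "tail G e" y] graph_symmetric[OF adj] y IH snoc
        by (metis length_append_singleton less_Suc_eq_le not_le_imp_less le_SucI order_refl)
    qed
    then show ?thesis
      using gdist_adj_le_Suc[OF x adj] IH snoc by simp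
  qed
qed

text \<open>The equality case of \<open>card_sphere_Suc_le\<close>. Since closer neighbours are
  unique, distinct vertices of a layer have disjoint neighbourhoods in the next one, and all
  neighbours except the predecessor lie there.\<close>

lemma card_sphere_Suc:
  assumes x: "x \<in> verts G"
    and full: "\<And>z. z \<in> sphere x i \<Longrightarrow> out_degree G z = max_degree G"
  shows "card (sphere x (Suc i)) = card (sphere x i) * branching i"
proof -
  have "card (sphere x (Suc i)) = card (\<Union>z\<in>sphere x i. nbrs G z \<inter> sphere x (Suc i))"
    using sphere_Suc[OF x] by simp
  also have "\<dots> = (\<Sum>z\<in>sphere x i. card (nbrs G z \<inter> sphere x (Suc i)))"
  proof (rule card_UN_disjoint)
    show "\<forall>z\<in>sphere x i. \<forall>z'\<in>sphere x i. z \<noteq> z' \<longrightarrow>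
        (nbrs G z \<inter> sphere x (Suc i)) \<inter> (nbrs G z' \<inter> sphere x (Suc i)) = {}"
      using closer_nbr_unique[OF x] by (fastforce simp: sphere_def nbrs_def)
  qed auto
  also have "\<dots> = (\<Sum>z\<in>sphere x i. branching i)"
  proof (rule sum.cong)
    fix z assume z: "z \<in> sphere x i"
    then have zv: "z \<in> verts G" "gdist G x z = i"
      by (auto simp: sphere_def)
    have deg: "card (nbrs G z) = max_degree G"
      using full[OF z] card_nbrs by simp
    have far: "y \<in> sphere x (Suc i)" if "z \<rightarrow> y" "\<not> gdist G x y \<le> i" for y
      using gdist_adj_le_Suc[OF x that(1)] that zv adj_in_verts by (auto simp: sphere_def)
    show "card (nbrs G z \<inter> sphere x (Suc i)) = branching i"
    proof (cases "i = 0")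
      case True
      then have "x = z"
        using zv x gdist_eq_0_iff by metis
      have "y \<in> sphere x (Suc i)" if "z \<rightarrow> y" for y
      proof -
        have "y \<noteq> x" "y \<in> verts G"
          using that \<open>x = z\<close> adj_not_same adj_in_verts by blast+
        then show ?thesis
          using far[OF that] True x gdist_eq_0_iff by fastforce
      qed
      then have "nbrs G z \<inter> sphere x (Suc i) = nbrs G z"
        by (auto simp: nbrs_def)
      with True deg show ?thesis
        by (simp add: branching_def)
    next
      case False
      then have "x \<noteq> z"
        using zv by auto
      then obtain u where u: "u \<rightarrow> z" "gdist G x z = Suc (gdist G x u)"
        using gdist_predecessor x zv by blast
      have "y \<in> sphere x (Suc i)" if "z \<rightarrow> y" "y \<noteq> u" for y
        using closer_nbr_unique[OF x u(1), of y] u zv that far graph_symmetric by force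
      moreover have "u \<notin> sphere x (Suc i)"
        using u zv by (simp add: sphere_def)
      ultimately have "nbrs G z \<inter> sphere x (Suc i) = nbrs G z - {u}"
        by (auto simp: nbrs_def)
      moreover have "u \<in> nbrs G z"
        using u graph_symmetric by (simp add: nbrs_def)
      ultimately show ?thesis
        using False deg by (simp add: branching_def)
    qed
  qed simp
  finally show ?thesis
    by simp
qed

end

section \<open>The lower bound by counting layers\<close>

lemma undirected_tree_iff: "undirected_tree T \<longleftrightarrow> tree_graph T"
  unfolding undirected_tree_def tree_graph_def connected_graph_def connected_graph_axioms_def
    tree_graph_axioms_def by (auto simp: not_le)

text \<open>The layers around a centre of \<open>G\<close> are compared with those around the
  distinguished vertex of \<open>B\<close>. The types of \<open>G\<close> and \<open>B\<close> are
  independent, so that two balanced trees can be compared as well.\<close>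

lemma rad_ge_balanced_tree:
  fixes G :: "('a,'b) pre_digraph" and B :: "('c,'d) pre_digraph"
  assumes "connected_graph G" and B: "balanced_tree (card (verts G)) (max_degree G) B"
  shows "rad B \<le> rad G"
proof (rule ccontr)
  assume less: "\<not> rad B \<le> rad G"
  interpret G: connected_graph G by fact
  interpret B: tree_graph B
    using B by (auto simp: balanced_tree_def tree_order_maxdeg_def undirected_tree_iff)
  have card: "card (verts B) = card (verts G)" and deg: "max_degree B = max_degree G"
    using B by (auto simp: balanced_tree_def tree_order_maxdeg_def)
  obtain x where x: "x \<in> verts B"
    and full: "\<And>z. z \<in> verts B \<Longrightarrow> gdist B z x + 2 \<le> ecc B x \<Longrightarrow> out_degree B z = max_degree G"
    using B by (auto simp: balanced_tree_def)
  obtain c where c: "c \<in> verts G" "ecc G c = rad G"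
    by (rule G.obtain_center)
  have r: "rad G < ecc B x"
    using less B.rad_le_ecc[OF x] by simp
  \<comment> \<open>The range includes \<open>i = ecc B x - 1\<close>: the size of that layer
    depends only on degrees in layers up to \<open>ecc B x - 2\<close>, where all degrees are
    maximal.\<close>
  have le: "card (G.sphere c i) \<le> card (B.sphere x i)" if "i < ecc B x" for i
    using that
  proof (induction i)
    case 0
    then show ?case
      using B.sphere_0 G.sphere_0 x c by simp
  next
    case (Suc i)
    have "card (G.sphere c (Suc i)) \<le> card (G.sphere c i) * G.branching i"
      using c by (intro G.card_sphere_Suc_le)
    also have "\<dots> \<le> card (B.sphere x i) * B.branching i"
      using Suc by (intro mult_mono) (auto simp: G.branching_def B.branching_def deg)
    also have "\<dots> = card (B.sphere x (Suc i))"
    proof (rule B.card_sphere_Suc[symmetric, OF x])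
      fix z assume "z \<in> B.sphere x i"
      then have "z \<in> verts B" "gdist B z x = i"
        using B.gdist_sym x by (auto simp: B.sphere_def)
      then show "out_degree B z = max_degree B"
        using full Suc.prems deg by simp
    qed
    finally show ?case .
  qed
  obtain y where "y \<in> verts B" "gdist B x y = ecc B x"
    by (rule B.obtain_farthest)
  then have "B.sphere x (ecc B x) \<noteq> {}"
    by (auto simp: B.sphere_def)
  then have pos: "0 < card (B.sphere x (ecc B x))"
    by (simp add: card_gt_0_iff)
  have "card (verts G) \<le> (\<Sum>i\<le>rad G. card (G.sphere c i))"
    using c by (intro G.card_verts_le_spheres) simp
  also have "\<dots> \<le> (\<Sum>i\<le>rad G. card (B.sphere x i))"
    using r by (intro sum_mono le) auto
  also have "\<dots> \<le> (\<Sum>i<ecc B x. card (B.sphere x i))"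
    using r by (intro sum_mono2) auto
  also have "\<dots> < (\<Sum>i\<le>ecc B x. card (B.sphere x i))"
    using pos by (simp flip: lessThan_Suc_atMost)
  also have "\<dots> \<le> card (verts B)"
    by (rule B.spheres_le_card_verts)
  finally show False
    using card by simp
qed

subsection \<open>Breadth-first search trees\<close>

text \<open>The values of \<open>h\<close> drop by one at each step, so \<open>f\<close> is
  injective; the bound on \<open>l\<close> keeps the subtraction from truncating.\<close>

lemma card_chain:
  fixes h :: "'a \<Rightarrow> nat"
  assumes "\<And>i. i < l \<Longrightarrow> h (f i) = h (f 0) - i" "l \<le> Suc (h (f 0))"
  shows "card (f ` {..<l}) = l"
proof -
  have "inj_on f {..<l}"
  proof (rule inj_onI)
    fix i j
    assume ij: "i \<in> {..<l}" "j \<in> {..<l}" "f i = f j"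
    then have "h (f 0) - i = h (f 0) - j"
      using assms(1) by (metis lessThan_iff)
    then show "i = j"
      using ij assms(2) by simp
  qed
  then show ?thesis
    by (simp add: card_image)
qed

section \<open>Depths, parents and ancestors\<close>

locale rooted_graph = connected_graph +
  fixes root :: 'a
  assumes root [simp]: "root \<in> verts G"
begin

definition dep :: "'a \<Rightarrow> nat" where
  "dep y = gdist G root y"

text \<open>One predecessor is chosen for each vertex. The root is its own parent, so iterated
  parents are total and stay at the root once they reach it.\<close>

definition par :: "'a \<Rightarrow> 'a" where
  "par y = (if y = root then root else SOME u. u \<rightarrow> y \<and> dep y = Suc (dep u))"

definition anc :: "nat \<Rightarrow> 'a \<Rightarrow> 'a" where
  "anc i = par ^^ i"

definition ancs :: "'a \<Rightarrow> 'a set" where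
  "ancs y = (\<lambda>i. anc i y) ` {..dep y}"

lemma dep_root [simp]: "dep root = 0"
  by (simp add: dep_def)

lemma dep_eq_0_iff: "y \<in> verts G \<Longrightarrow> dep y = 0 \<longleftrightarrow> y = root"
  unfolding dep_def using gdist_eq_0_iff[of root y] by auto

lemma par_root [simp]: "par root = root"
  by (simp add: par_def)

lemma par:
  assumes "y \<in> verts G" "y \<noteq> root"
  shows "par y \<rightarrow> y" "dep y = Suc (dep (par y))"
proof -
  have "\<exists>u. u \<rightarrow> y \<and> dep y = Suc (dep u)"
    using gdist_predecessor[of root y] assms unfolding dep_def by (metis root)
  from someI_ex[OF this] show "par y \<rightarrow> y" "dep y = Suc (dep (par y))"
    using assms by (simp_all add: par_def)
qed

lemma par_in_verts: "y \<in> verts G \<Longrightarrow> par y \<in> verts G"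
  using par(1) adj_in_verts by (cases "y = root") auto

lemma dep_par: "y \<in> verts G \<Longrightarrow> dep (par y) = dep y - 1"
  using par(2) by (cases "y = root") auto

lemma anc_0 [simp]: "anc 0 y = y"
  by (simp add: anc_def)

lemma anc_Suc [simp]: "anc (Suc i) y = par (anc i y)"
  by (simp add: anc_def)

lemma anc_add: "anc (i + j) y = anc i (anc j y)"
  by (simp add: anc_def funpow_add)

lemma anc_in_verts: "y \<in> verts G \<Longrightarrow> anc i y \<in> verts G"
  by (induction i) (auto intro: par_in_verts)

lemma dep_anc: "y \<in> verts G \<Longrightarrow> dep (anc i y) = dep y - i"
  by (induction i) (auto simp: dep_par anc_in_verts)

lemma anc_dep: "y \<in> verts G \<Longrightarrow> anc (dep y) y = root"
  using dep_anc[of y "dep y"] anc_in_verts dep_eq_0_iff by simp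

lemma par_ancs: "y \<in> verts G \<Longrightarrow> z \<in> ancs y \<Longrightarrow> par z \<in> ancs y"
proof -
  assume y: "y \<in> verts G" and "z \<in> ancs y"
  then obtain i where i: "i \<le> dep y" "z = anc i y"
    by (auto simp: ancs_def)
  show "par z \<in> ancs y"
  proof (cases "i = dep y")
    case True
    then show ?thesis
      using i y anc_dep \<open>z \<in> ancs y\<close> by simp
  next
    case False
    then show ?thesis
      using i unfolding ancs_def by (intro image_eqI[of _ _ "Suc i"]) auto
  qed
qed

lemma ancs_subset: "y \<in> verts G \<Longrightarrow> ancs y \<subseteq> verts G"
  by (auto simp: ancs_def anc_in_verts)

lemma finite_ancs [simp]: "finite (ancs y)"
  by (simp add: ancs_def)

lemma self_in_ancs: "y \<in> ancs y"
  unfolding ancs_def by (intro image_eqI[of _ _ 0]) auto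

lemma root_in_ancs: "y \<in> verts G \<Longrightarrow> root \<in> ancs y"
  unfolding ancs_def using anc_dep by (intro image_eqI[of _ _ "dep y"]) auto

lemma card_ancs_below: "y \<in> verts G \<Longrightarrow> l \<le> Suc (dep y) \<Longrightarrow> card ((\<lambda>i. anc i y) ` {..<l}) = l"
  using card_chain[of l dep "\<lambda>i. anc i y"] by (simp add: dep_anc)

lemma card_ancs: "y \<in> verts G \<Longrightarrow> card (ancs y) = Suc (dep y)"
  using card_ancs_below[of y "Suc (dep y)"] by (simp add: ancs_def lessThan_Suc_atMost)

text \<open>A branch has exactly one vertex at each depth up to \<open>dep y\<close>, so an ancestor
  is determined by its depth.\<close>

lemma in_ancs_iff:
  assumes "y \<in> verts G"
  shows "z \<in> ancs y \<longleftrightarrow> dep z \<le> dep y \<and> z = anc (dep y - dep z) y"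
proof
  assume "z \<in> ancs y"
  then obtain i where "i \<le> dep y" "z = anc i y"
    by (auto simp: ancs_def)
  then show "dep z \<le> dep y \<and> z = anc (dep y - dep z) y"
    using assms by (simp add: dep_anc)
next
  assume "dep z \<le> dep y \<and> z = anc (dep y - dep z) y"
  then show "z \<in> ancs y"
    unfolding ancs_def by (intro image_eqI[of _ _ "dep y - dep z"]) auto
qed

lemma ancs_anc_subset:
  assumes "y \<in> verts G"
  shows "ancs (anc i y) \<subseteq> ancs y"
proof (cases "i \<le> dep y")
  case True
  then show ?thesis
    using assms by (auto simp: ancs_def dep_anc simp flip: anc_add)
next
  case False
  then have "anc i y = root"
    using assms dep_anc[of y i] dep_eq_0_iff[of "anc i y"] anc_in_verts by simp
  then show ?thesis
    using root_in_ancs[OF assms] by (simp add: ancs_def)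
qed

lemma nbrs_root_iff: "z \<in> nbrs G root \<longleftrightarrow> z \<in> verts G \<and> dep z = 1"
proof
  assume "z \<in> nbrs G root"
  then have z: "root \<rightarrow> z" "z \<in> verts G"
    using adj_in_verts by (auto simp: nbrs_def)
  then have "z \<noteq> root"
    using adj_not_same by blast
  then show "z \<in> verts G \<and> dep z = 1"
    using z gdist_adj_le[OF z(1)] dep_eq_0_iff[of z] by (simp add: dep_def)
next
  assume z: "z \<in> verts G \<and> dep z = 1"
  then have "z \<noteq> root"
    by auto
  moreover have "par z = root"
    using z dep_par[of z] par_in_verts[of z] dep_eq_0_iff by simp
  ultimately show "z \<in> nbrs G root"
    using par(1)[of z] z by (simp add: nbrs_def)
qed

text \<open>The neighbours of the root are the vertices of depth 1, and a branch contains just one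
  of these. The later counts subtract this overlap.\<close>

lemma ancs_Int_nbrs_root:
  assumes "y \<in> verts G" "y \<noteq> root"
  shows "ancs y \<inter> nbrs G root = {anc (dep y - 1) y}"
proof -
  have pos: "dep y \<noteq> 0"
    using assms dep_eq_0_iff by simp
  have "z = anc (dep y - 1) y" if "z \<in> ancs y" "z \<in> nbrs G root" for z
    using that in_ancs_iff[OF assms(1), of z] by (metis nbrs_root_iff)
  moreover have "anc (dep y - 1) y \<in> ancs y"
    by (auto simp: ancs_def)
  moreover have "anc (dep y - 1) y \<in> nbrs G root"
    using pos assms by (simp add: nbrs_root_iff dep_anc anc_in_verts)
  ultimately show ?thesis
    by blast
qed

lemma gdist_anc_le: "y \<in> verts G \<Longrightarrow> gdist G (anc i y) y \<le> i"
proof (induction i)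
  case (Suc i)
  let ?z = "anc i y"
  have z: "?z \<in> verts G" "par ?z \<in> verts G"
    using Suc.prems anc_in_verts par_in_verts by auto
  have "gdist G (par ?z) ?z \<le> 1"
    using par(1)[OF z(1)] gdist_adj_le z by (cases "?z = root") auto
  then show ?case
    using gdist_triangle[of "par ?z" ?z y] Suc z by simp
qed simp

text \<open>The edges joining a vertex to its parent, in both directions. \<open>W = verts G\<close>
  gives a spanning tree; a smaller set closed under \<open>par\<close> will give the comet inside
  it.\<close>

definition bfs_tree :: "'a set \<Rightarrow> ('a,'b) pre_digraph" where
  "bfs_tree W = \<lparr>verts = W,
     arcs = {e \<in> arcs G. tail G e \<in> W \<and> head G e \<in> W \<and>
       (tail G e = par (head G e) \<or> head G e = par (tail G e))},
     tail = tail G, head = head G\<rparr>"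

lemma verts_bfs_tree [simp]: "verts (bfs_tree W) = W"
  and tail_bfs_tree [simp]: "tail (bfs_tree W) = tail G"
  and head_bfs_tree [simp]: "head (bfs_tree W) = head G"
  by (simp_all add: bfs_tree_def)

lemma subgraph_bfs_tree:
  assumes "W \<subseteq> W'" "W' \<subseteq> verts G"
  shows "subgraph (bfs_tree W) (bfs_tree W')"
  using assms by (intro subgraphI) (auto simp: bfs_tree_def compatible_def wf_digraph_def)

lemma subgraph_bfs_tree_graph:
  assumes "W \<subseteq> verts G"
  shows "subgraph (bfs_tree W) G"
  using assms wf_digraph by (intro subgraphI) (auto simp: bfs_tree_def compatible_def wf_digraph_def)

lemma bfs_tree_adj_iff:
  "u \<rightarrow>\<^bsub>bfs_tree W\<^esub> w \<longleftrightarrow> u \<in> W \<and> w \<in> W \<and> u \<rightarrow> w \<and> (u = par w \<or> w = par u)"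
  by (auto simp: bfs_tree_def arcs_ends_conv)

lemma graph_bfs_tree:
  assumes "W \<subseteq> verts G"
  shows "graph (bfs_tree W)"
proof -
  interpret D: digraph "bfs_tree W"
    using subgraph_bfs_tree_graph[OF assms] by (rule digraph_subgraph)
  have "symmetric (bfs_tree W)"
    unfolding symmetric_def sym_def using graph_symmetric by (auto simp: bfs_tree_adj_iff)
  then show ?thesis
    by (rule D.graphI)
qed

lemma bfs_tree_walk_to_root:
  assumes W: "W \<subseteq> verts G" "par ` W \<subseteq> W" and "y \<in> W"
  obtains p where "pre_digraph.awalk (bfs_tree W) y p root" "length p = dep y"
    "set (pre_digraph.awalk_verts (bfs_tree W) y p) = ancs y"
proof -
  interpret H: graph "bfs_tree W"
    using W by (intro graph_bfs_tree)
  have "\<exists>p. H.awalk y p root \<and> length p = dep y \<and> set (H.awalk_verts y p) = ancs y"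
    using \<open>y \<in> W\<close>
  proof (induction "dep y" arbitrary: y)
    case 0
    then have "y = root"
      using W dep_eq_0_iff by (metis subsetD)
    with 0 show ?case
      by (intro exI[of _ "[]"]) (simp add: H.awalk_Nil_iff ancs_def)
  next
    case (Suc d)
    then have y: "y \<in> verts G" "y \<noteq> root"
      using W by auto
    have "par y \<in> W"
      using W Suc.prems by blast
    moreover have d: "d = dep (par y)"
      using par(2)[OF y] Suc.hyps by simp
    ultimately obtain p where p: "H.awalk (par y) p root" "length p = dep (par y)"
      "set (H.awalk_verts (par y) p) = ancs (par y)"
      using Suc.hyps(1) by blast
    have "y \<rightarrow>\<^bsub>bfs_tree W\<^esub> par y"
      using Suc.prems \<open>par y \<in> W\<close> graph_symmetric[OF par(1)[OF y]] by (simp add: bfs_tree_adj_iff)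
    then obtain e where e: "e \<in> arcs (bfs_tree W)" "tail G e = y" "head G e = par y"
      by auto
    have "ancs y = insert y (ancs (par y))"
      using par(2)[OF y]
      by (simp add: ancs_def atMost_Suc_eq_insert_0 image_image anc_def funpow_swap1)
    then have "set (H.awalk_verts y (e # p)) = ancs y"
      using e p by simp
    moreover have "H.awalk y (e # p) root"
      using e p by (simp add: H.awalk_Cons_iff)
    ultimately show ?case
      using p par(2)[OF y] by (intro exI[of _ "e # p"]) simp
  qed
  then show ?thesis
    using that by blast
qed

text \<open>
  On a cycle both neighbours of a vertex of maximal depth are its parent, hence they coincide.
\<close>

lemma cycle_bfs_tree:
  assumes W: "W \<subseteq> verts G" and p: "pre_digraph.cycle (bfs_tree W) p"
  shows "length p < 3"
proof (rule ccontr)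
  assume "\<not> length p < 3"
  then have len: "3 \<le> length p"
    by simp
  interpret H: graph "bfs_tree W"
    using W by (intro graph_bfs_tree)
  let ?n = "length p"
  obtain u where w: "H.awalk u p u" and d: "distinct (tl (H.awalk_verts u p))" and "p \<noteq> []"
    using p unfolding H.cycle_def by blast
  have heads: "H.awalk_verts u p = u # map (head G) p"
    using w \<open>p \<noteq> []\<close> H.awalk_verts_conv'[of u p u]
    by (cases p) (auto simp: H.awalk_simps H.awalk_def)
  have tails: "H.awalk_verts u p = map (tail G) p @ [u]"
    using w \<open>p \<noteq> []\<close> H.awalk_verts_conv[of u p] H.awlast_of_awalk[OF w] heads
    by (auto simp: H.awalk_def last_map)
  have dist: "inj_on (\<lambda>i. head G (p ! i)) {..<?n}"
    using d heads by (auto simp: distinct_conv_nth inj_on_def)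
  \<comment> \<open>Positions on the cycle are taken modulo its length, so that the first and the
    last arc need no separate treatment.\<close>
  have succ: "head G (p ! i) = tail G (p ! (Suc i mod ?n))" if "i < ?n" for i
  proof -
    have eq: "u # map (head G) p = map (tail G) p @ [u]"
      using heads tails by simp
    then have "(u # map (head G) p) ! Suc i = (map (tail G) p @ [u]) ! Suc i"
      by simp
    then have *: "head G (p ! i) = (if Suc i < ?n then tail G (p ! Suc i) else u)"
      using that by (simp add: nth_append)
    have "(u # map (head G) p) ! 0 = (map (tail G) p @ [u]) ! 0"
      using eq by simp
    then have "tail G (p ! 0) = u"
      using len by (simp add: nth_append split: if_splits)
    then show ?thesis
      using * that by (cases "Suc i < ?n") (auto simp: not_less le_Suc_eq mod_Suc)
  qed
  have arc: "p ! i \<in> arcs (bfs_tree W)" if "i < ?n" for i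
    using w that by (auto simp: H.awalk_def)
  define m where "m = Max ((\<lambda>i. dep (head G (p ! i))) ` {..<?n})"
  have "m \<in> (\<lambda>i. dep (head G (p ! i))) ` {..<?n}"
    unfolding m_def using \<open>p \<noteq> []\<close> by (intro Max_in) auto
  then obtain i where i: "i < ?n" "dep (head G (p ! i)) = m"
    by auto
  have max: "dep (head G (p ! j)) \<le> m" if "j < ?n" for j
    unfolding m_def using that by (intro Max_ge) auto
  let ?x = "head G (p ! i)"
  \<comment> \<open>A vertex \<open>z\<close> other than the root with parent \<open>?x\<close>
    would have depth \<open>m + 1\<close>, against the maximality of \<open>m\<close>; for the root,
    \<open>?x = par z\<close> would give \<open>?x = z\<close>.\<close>
  have up: "z = par ?x"
    if "z \<in> verts G" "dep z \<le> m" "z \<noteq> ?x" "z = par ?x \<or> ?x = par z" for z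
    using that par(2)[of z] i by (cases "z = root") auto
  \<comment> \<open>The positions after and before \<open>i\<close>; they differ because the cycle
    has length at least 3.\<close>
  define j where "j = Suc i mod ?n"
  define l where "l = (if i = 0 then ?n - 1 else i - 1)"
  have jl: "j < ?n" "l < ?n" "j \<noteq> l" "Suc l mod ?n = i"
    using i len by (auto simp: j_def l_def mod_Suc)
  have "head G (p ! j) = par ?x"
  proof (rule up)
    show "head G (p ! j) \<in> verts G"
      using arc[OF jl(1)] by (auto simp: bfs_tree_def)
    show "dep (head G (p ! j)) \<le> m"
      using max jl by simp
    show "head G (p ! j) \<noteq> ?x"
      using arc[OF jl(1)] succ[OF i(1)] H.no_loops
      by (metis (lifting) head_bfs_tree j_def tail_bfs_tree)
    show "head G (p ! j) = par ?x \<or> ?x = par (head G (p ! j))"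
      using arc[OF jl(1)] succ[OF i(1)] by (auto simp: j_def bfs_tree_def)
  qed
  moreover have "head G (p ! l) = par ?x"
  proof (rule up)
    show "head G (p ! l) \<in> verts G"
      using arc[OF jl(2)] by (auto simp: bfs_tree_def)
    show "dep (head G (p ! l)) \<le> m"
      using max jl by simp
    show "head G (p ! l) \<noteq> ?x"
      using arc[OF i(1)] succ[OF jl(2)] jl H.no_loops by (metis head_bfs_tree tail_bfs_tree)
    show "head G (p ! l) = par ?x \<or> ?x = par (head G (p ! l))"
      using arc[OF i(1)] succ[OF jl(2)] jl by (auto simp: bfs_tree_def)
  qed
  ultimately show False
    using dist jl by (metis inj_onD lessThan_iff)
qed

lemma tree_graph_bfs_tree:
  assumes W: "W \<subseteq> verts G" "par ` W \<subseteq> W" "root \<in> W"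
  shows "tree_graph (bfs_tree W)"
proof -
  interpret H: graph "bfs_tree W"
    using W by (intro graph_bfs_tree)
  have reach: "y \<rightarrow>\<^sup>*\<^bsub>bfs_tree W\<^esub> root" if "y \<in> W" for y
    using bfs_tree_walk_to_root[OF W(1,2) that] H.reachable_awalkI by metis
  have "strongly_connected (bfs_tree W)"
  proof
    show "verts (bfs_tree W) \<noteq> {}"
      using W by auto
    fix u v
    assume "u \<in> verts (bfs_tree W)" "v \<in> verts (bfs_tree W)"
    then have "u \<rightarrow>\<^sup>*\<^bsub>bfs_tree W\<^esub> root" "v \<rightarrow>\<^sup>*\<^bsub>bfs_tree W\<^esub> root"
      using reach by simp_all
    then show "u \<rightarrow>\<^sup>*\<^bsub>bfs_tree W\<^esub> v"
      using H.symmetric_reachable' H.reachable_trans by metis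
  qed
  then show ?thesis
    using cycle_bfs_tree[OF W(1)] by unfold_locales (auto simp: H.connected_conv)
qed

text \<open>All neighbours of the root have it as parent, so the root loses no edge; no degree
  exceeds that in \<open>G\<close>.\<close>

lemma max_degree_bfs_tree:
  assumes W: "W \<subseteq> verts G" "root \<in> W" "nbrs G root \<subseteq> W"
    and deg: "out_degree G root = max_degree G"
  shows "out_degree (bfs_tree W) root = max_degree G" "max_degree (bfs_tree W) = max_degree G"
proof -
  interpret H: graph "bfs_tree W"
    using W by (intro graph_bfs_tree)
  have "par z = root" if "z \<in> nbrs G root" for z
    using that dep_par[of z] par_in_verts[of z] dep_eq_0_iff by (simp add: nbrs_root_iff)
  then have "nbrs (bfs_tree W) root = nbrs G root"
    using W by (auto simp: nbrs_def bfs_tree_adj_iff)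
  then show "out_degree (bfs_tree W) root = max_degree G"
    using card_nbrs H.card_nbrs deg by metis
  moreover have "out_degree (bfs_tree W) u \<le> max_degree G" if "u \<in> W" for u
    using subgraph_out_degree[OF subgraph_bfs_tree_graph[OF W(1)], of u]
      out_degree_le_max_degree[of u] that W by auto
  ultimately show "max_degree (bfs_tree W) = max_degree G"
    using W by (intro H.max_degree_eqI[of root]) auto
qed

subsection \<open>Longest branches\<close>

text \<open>For \<open>a\<close> other than the root, these are the vertices whose tree path to
  \<open>a\<close> has the root in its interior.\<close>

definition off_branch :: "'a \<Rightarrow> 'a set" where
  "off_branch a = {y \<in> verts G. y \<noteq> root \<and> ancs y \<inter> ancs a = {root}}"

text \<open>Climbing from \<open>y\<close>, the first vertex on the branch to \<open>a\<close> is
  taken; the climb succeeds since the root lies on both branches.\<close>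

lemma obtain_junction:
  assumes "a \<in> verts G" "y \<in> verts G"
  obtains i where "i \<le> dep y" "anc i y \<in> ancs a" "\<And>s. s < i \<Longrightarrow> anc s y \<notin> ancs a"
proof -
  define i where "i = (LEAST i. anc i y \<in> ancs a)"
  have ex: "anc (dep y) y \<in> ancs a"
    using assms by (simp add: anc_dep root_in_ancs)
  show ?thesis
  proof
    show "i \<le> dep y"
      unfolding i_def using ex by (rule Least_le)
    show "anc i y \<in> ancs a"
      unfolding i_def using ex by (rule LeastI)
    show "anc s y \<notin> ancs a" if "s < i" for s
      using that unfolding i_def by (rule not_less_Least)
  qed
qed

text \<open>Inclusion-exclusion for three sets: the branch to \<open>a\<close>, the first
  \<open>i\<close> vertices climbing from \<open>y\<close>, and the neighbours of the root. The
  first contains one neighbour of the root; the second contains one only if the climb ends at the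
  root.\<close>

lemma branch_count:
  assumes a: "a \<in> verts G" "a \<noteq> root" and y: "y \<in> verts G" and i: "i \<le> dep y"
    and off: "\<And>s. s < i \<Longrightarrow> anc s y \<notin> ancs a"
  shows "dep a + i + out_degree G root \<le> card (verts G) + (if i = dep y \<and> y \<noteq> root then 1 else 0)"
proof -
  define B where "B = (\<lambda>s. anc s y) ` {..<i}"
  define N where "N = nbrs G root"
  have fin: "finite B" "finite N"
    by (simp_all add: B_def N_def)
  have AB: "card (ancs a \<union> B) = Suc (dep a) + i"
    using off a card_ancs_below[OF y, of i] i fin
    by (subst card_Un_disjoint) (auto simp: B_def card_ancs)
  have "card (B \<inter> N) \<le> (if i = dep y \<and> y \<noteq> root then 1 else 0)"
  proof -
    have "B \<inter> N \<subseteq> (if i = dep y \<and> y \<noteq> root then {anc (dep y - 1) y} else {})"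
    proof
      fix z assume "z \<in> B \<inter> N"
      then obtain s where s: "s < i" "z = anc s y" "dep z = 1"
        by (auto simp: B_def N_def nbrs_root_iff)
      then have "dep y - s = 1"
        using y by (simp add: dep_anc)
      with s i have "s = dep y - 1" "i = dep y" "y \<noteq> root"
        by auto
      with s show "z \<in> (if i = dep y \<and> y \<noteq> root then {anc (dep y - 1) y} else {})"
        by simp
    qed
    from card_mono[OF _ this] show ?thesis
      by (auto split: if_splits)
  qed
  moreover have "card (ancs a \<inter> N) = 1"
    using ancs_Int_nbrs_root[OF a] by (simp add: N_def)
  moreover have "card ((ancs a \<union> B) \<inter> N) \<le> card (ancs a \<inter> N) + card (B \<inter> N)"
    unfolding Int_Un_distrib2 by (rule card_Un_le)
  moreover have "card (ancs a \<union> B) + card N = card (ancs a \<union> B \<union> N) + card ((ancs a \<union> B) \<inter> N)"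
    using fin by (intro card_Un_Int) auto
  moreover have "card (ancs a \<union> B \<union> N) \<le> card (verts G)"
    using ancs_subset[OF a(1)] anc_in_verts[OF y] nbrs_subset
    by (intro card_mono) (auto simp: B_def N_def)
  ultimately show ?thesis
    using AB card_nbrs[of root] by (simp add: N_def)
qed

lemma junction_at_root:
  assumes a: "a \<in> verts G" and y: "y \<in> verts G" "y \<noteq> root"
    and off: "\<And>s. s < dep y \<Longrightarrow> anc s y \<notin> ancs a"
  shows "y \<in> off_branch a"
proof -
  have "z = root" if z: "z \<in> ancs y" "z \<in> ancs a" for z
  proof -
    obtain s where s: "s \<le> dep y" "z = anc s y"
      using z(1) by (auto simp: ancs_def)
    with off[of s] z(2) have "s = dep y"
      by force
    with s y show ?thesis
      by (simp add: anc_dep)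
  qed
  then show ?thesis
    using a y root_in_ancs unfolding off_branch_def by blast
qed

lemma off_branch_bound:
  assumes "a \<in> verts G" "a \<noteq> root" "y \<in> off_branch a"
  shows "dep a + dep y + out_degree G root \<le> card (verts G) + 1"
proof -
  have y: "y \<in> verts G" "y \<noteq> root"
    using assms by (auto simp: off_branch_def)
  have "anc s y \<notin> ancs a" if "s < dep y" for s
  proof
    assume "anc s y \<in> ancs a"
    moreover have "anc s y \<in> ancs y"
      using that by (auto simp: ancs_def)
    ultimately have "anc s y = root"
      using assms(3) by (auto simp: off_branch_def)
    then show False
      using dep_anc[OF y(1), of s] that by simp
  qed
  from branch_count[OF assms(1,2) y(1) order.refl this] show ?thesis
    using y by simp
qed

text \<open>The branch to \<open>a\<close> uses up only one of the at least two neighbours of the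
  root.\<close>

lemma off_branch_nonempty:
  assumes a: "a \<in> verts G" "a \<noteq> root" and deg: "2 \<le> out_degree G root"
  obtains y where "y \<in> off_branch a" "dep y = 1"
proof -
  have "\<not> nbrs G root \<subseteq> {anc (dep a - 1) a}"
    using card_mono[of "{anc (dep a - 1) a}" "nbrs G root"] deg by (auto simp: card_nbrs)
  then obtain y where y: "y \<in> nbrs G root" "y \<notin> ancs a"
    using ancs_Int_nbrs_root[OF a] by blast
  then have "y \<in> verts G" "dep y = 1" "y \<noteq> root"
    by (auto simp: nbrs_root_iff)
  with y show ?thesis
    using that junction_at_root[OF a(1), of y] by (auto simp: less_Suc_eq_0_disj)
qed

text \<open>Either the root itself has eccentricity at most \<open>r\<close>, or the vertex
  \<open>c\<close> at height \<open>r\<close> above the deepest vertex \<open>a\<close> does. Each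
  \<open>y\<close> is reached from \<open>c\<close> via the junction \<open>z\<close> of its branch
  with that of \<open>a\<close>, and the position of \<open>z\<close> decides which bound
  applies.\<close>

lemma rad_le_if_branches_short:
  assumes a: "a \<in> verts G" "dep a = ecc G root" and deg: "2 \<le> out_degree G root"
    and short: "\<And>y. y \<in> off_branch a \<Longrightarrow> dep a + dep y \<le> m"
    and m: "card (verts G) \<le> m + out_degree G root + 1" "m \<le> 2 * r"
  shows "rad G \<le> r"
proof (cases "dep a \<le> r")
  case True
  then show ?thesis
    using a rad_le_ecc[OF root] by simp
next
  case False
  then have "a \<noteq> root"
    by auto
  define c where "c = anc r a"
  have c: "c \<in> verts G" "dep c = dep a - r"
    using a by (simp_all add: c_def anc_in_verts dep_anc)
  have m': "dep a + 1 \<le> m"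
    using off_branch_nonempty[OF a(1) \<open>a \<noteq> root\<close> deg] short by metis
  have "gdist G c y \<le> r" if y: "y \<in> verts G" for y
  proof -
    obtain i where i: "i \<le> dep y" "anc i y \<in> ancs a" "\<And>s. s < i \<Longrightarrow> anc s y \<notin> ancs a"
      using obtain_junction a(1) y by blast
    define z where "z = anc i y"
    have z: "z \<in> verts G" "dep z = dep y - i" "anc (dep a - dep z) a = z"
      using y i(2) in_ancs_iff[OF a(1), of z] by (metis z_def anc_in_verts dep_anc)+
    have zy: "gdist G z y \<le> i"
      using y by (simp add: z_def gdist_anc_le)
    have tri: "gdist G c y \<le> gdist G c z + gdist G z y"
      using c z y by (intro gdist_triangle)
    have ya: "dep y \<le> dep a"
      using gdist_le_ecc[OF y, of root] a by (simp add: dep_def)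
    show ?thesis
    proof (cases "dep c \<le> dep z")
      \<comment> \<open>Here \<open>z\<close> is \<open>c\<close> or lies below it, so the route
        descends all the way to \<open>y\<close> and has length at most
        \<open>dep y - dep c\<close>. As \<open>a\<close> is deepest, this is at most
        \<open>dep a - dep c = r\<close>.\<close>
      case True
      have "anc (dep z - dep c) z = anc (dep z - dep c + (dep a - dep z)) a"
        using z(3) by (simp add: anc_add)
      also have "dep z - dep c + (dep a - dep z) = r"
        using True ya c(2) z(2) False by simp
      finally have "anc (dep z - dep c) z = c"
        by (simp add: c_def)
      then have "gdist G c z \<le> dep z - dep c"
        using gdist_anc_le[OF z(1)] by metis
      then show ?thesis
        using tri zy z c ya True i(1) by simp
    next
      case less: False
      have "dep z \<le> dep a"
        using z ya by simp
      then have "dep c - dep z + r = dep a - dep z"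
        using c(2) less False by simp
      then have "anc (dep c - dep z) c = z"
        using z(3) by (simp add: c_def flip: anc_add)
      then have "gdist G c z \<le> dep c - dep z"
        using gdist_anc_le[OF c(1)] gdist_sym c z by metis
      then have *: "gdist G c y \<le> dep c - dep z + i"
        using tri zy by simp
      show ?thesis
      proof (cases "i = dep y \<and> y \<noteq> root")
        \<comment> \<open>The junction is the root, so the route has length at most
          \<open>dep c + dep y = dep a + dep y - r\<close>, which is at most
          \<open>m - r\<close>.\<close>
        case True
        then have "y \<in> off_branch a"
          using junction_at_root a(1) y i(3) by simp
        then show ?thesis
          using * short[of y] z(2) c(2) m(2) True False by linarith
      next
        case F: False
        then have "dep a + i + out_degree G root \<le> card (verts G)"
          using branch_count[OF a(1) \<open>a \<noteq> root\<close> y i(1) i(3)] by (auto split: if_splits)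
        \<comment> \<open>The count only gives \<open>dep a + i \<le> m + 1\<close>. The surplus 1
          is absorbed by \<open>dep z\<close> if that is positive; if \<open>i = 0\<close>, then
          \<open>m'\<close> bounds \<open>dep a\<close> instead.\<close>
        moreover have "dep z \<noteq> 0 \<or> i = 0"
          using F z i(1) y dep_eq_0_iff by auto
        ultimately show ?thesis
          using * c m m' False by linarith
      qed
    qed
  qed
  then show ?thesis
    using rad_le_ecc[OF c(1)] ecc_le_iff[of c r] by simp
qed

section \<open>The upper bound and its equality case\<close>

lemma rad_le:
  assumes deg: "2 \<le> out_degree G root"
  shows "rad G \<le> (card (verts G) + 2 - out_degree G root) div 2"
proof -
  obtain a where a: "a \<in> verts G" "gdist G root a = ecc G root"
    by (rule obtain_farthest)
  have "out_degree G root = card (nbrs G root)"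
    by (simp add: card_nbrs)
  then obtain z where z: "z \<in> nbrs G root"
    using deg by fastforce
  have "dep a \<ge> dep z"
    using z a gdist_le_ecc[of z root] by (simp add: dep_def nbrs_root_iff)
  then have "a \<noteq> root"
    using z by (auto simp: nbrs_root_iff)
  show ?thesis
  proof (rule rad_le_if_branches_short[OF a(1) _ deg])
    show "dep a = ecc G root"
      using a by (simp add: dep_def)
    \<comment> \<open>This is \<open>m = n - k + 1\<close> for a root of degree \<open>k\<close>;
      the radius bound is half of it, rounded up.\<close>
    show "dep a + dep y \<le> card (verts G) + 1 - out_degree G root" if "y \<in> off_branch a" for y
      using off_branch_bound[OF a(1) \<open>a \<noteq> root\<close> that] by simp
  qed auto
qed

lemma contains_comet_star:
  assumes deg: "out_degree G root = max_degree G" "2 \<le> max_degree G"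
    and n: "max_degree G + 2 \<le> card (verts G)"
    and rad: "(card (verts G) + 2 - max_degree G) div 2 \<le> rad G"
  shows "comet_star (card (verts G)) (max_degree G) (bfs_tree (verts G))"
proof -
  define n where "n = card (verts G)"
  define k where "k = max_degree G"
  define l where "l = n - k"
  have l: "2 \<le> l" "n = l + k" "2 \<le> k"
    using n deg by (auto simp: l_def n_def k_def)
  obtain a where a: "a \<in> verts G" "gdist G root a = ecc G root"
    by (rule obtain_farthest)
  have "\<exists>y\<in>off_branch a. l \<le> dep a + dep y"
  proof (rule ccontr)
    assume contra: "\<not> ?thesis"
    \<comment> \<open>With \<open>m = l - 1\<close> the size condition on \<open>m\<close> holds
      with equality, and the result falls one short of the assumed
      \<open>(l + 2) div 2\<close>.\<close>
    have "rad G \<le> l div 2"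
    proof (rule rad_le_if_branches_short[OF a(1), where m = "l - 1"])
      show "dep a = ecc G root"
        using a by (simp add: dep_def)
      show "dep a + dep y \<le> l - 1" if "y \<in> off_branch a" for y
        using contra that by fastforce
    qed (use l deg in \<open>auto simp: n_def k_def\<close>)
    then show False
      using rad l by (simp add: n_def[symmetric] k_def[symmetric])
  qed
  then obtain b where b: "b \<in> off_branch a" "l \<le> dep a + dep b"
    by blast
  have bv: "b \<in> verts G" "b \<noteq> root"
    using b by (auto simp: off_branch_def)
  have "dep b \<le> dep a"
    using gdist_le_ecc[OF bv(1), of root] a by (simp add: dep_def)
  moreover have "dep b \<noteq> 0"
    using bv by (simp add: dep_eq_0_iff)
  \<comment> \<open>The path is trimmed to length exactly \<open>l\<close>: the arm to
    \<open>b\<close> keeps as much as possible while leaving at least one edge for the arm to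
    \<open>a\<close>.\<close>
  ultimately obtain s t where st: "1 \<le> s" "s \<le> dep a" "1 \<le> t" "t \<le> dep b" "s + t = l"
    using b(2) l(1) that[of "l - min (dep b) (l - 1)" "min (dep b) (l - 1)"] by linarith
  define x where "x = anc (dep a - s) a"
  define y where "y = anc (dep b - t) b"
  have x: "x \<in> verts G" "dep x = s" "x \<noteq> root"
    using a st by (auto simp: x_def anc_in_verts dep_anc simp flip: dep_eq_0_iff)
  have y: "y \<in> verts G" "dep y = t" "y \<noteq> root"
    using bv st by (auto simp: y_def anc_in_verts dep_anc simp flip: dep_eq_0_iff)
  have "ancs x \<subseteq> ancs a" "ancs y \<subseteq> ancs b"
    unfolding x_def y_def using a bv by (simp_all add: ancs_anc_subset)
  then have disj: "ancs x \<inter> ancs y = {root}"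
    using b(1) root_in_ancs[OF x(1)] root_in_ancs[OF y(1)] by (auto simp: off_branch_def)
  define P where "P = ancs x \<union> ancs y"
  define W where "W = P \<union> nbrs G root"
  have cardP: "card P = Suc l"
    using card_Un_Int[of "ancs x" "ancs y"] card_ancs x y disj st by (simp add: P_def)
  have "P \<inter> nbrs G root = {anc (s - 1) x, anc (t - 1) y}"
    using ancs_Int_nbrs_root[OF x(1,3)] ancs_Int_nbrs_root[OF y(1,3)] x y by (auto simp: P_def)
  moreover have "anc (s - 1) x \<noteq> anc (t - 1) y"
  proof
    assume eq: "anc (s - 1) x = anc (t - 1) y"
    have "anc (s - 1) x \<in> ancs x" "anc (t - 1) y \<in> ancs y"
      using x y by (auto simp: ancs_def)
    then have "anc (s - 1) x = root"
      using disj eq by auto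
    then show False
      using dep_anc[OF x(1), of "s - 1"] x st by simp
  qed
  ultimately have "card (P \<inter> nbrs G root) = 2"
    by simp
  moreover have "finite P"
    by (simp add: P_def)
  \<comment> \<open>The path has \<open>l + 1\<close> vertices and two of the \<open>k\<close>
    neighbours of the root lie on it, so \<open>W\<close> has \<open>l + 1 + k - 2\<close>
    elements.\<close>
  ultimately have cardW: "card W = n - 1"
    using card_Un_Int[of P "nbrs G root"] cardP card_nbrs[of root] deg l
    by (simp add: W_def k_def)
  have Wv: "W \<subseteq> verts G"
    using ancs_subset x y nbrs_subset by (auto simp: W_def P_def)
  have rW: "root \<in> W"
    using disj by (auto simp: W_def P_def)
  have parW: "par ` W \<subseteq> W"
  proof -
    have "par z = root" if "z \<in> nbrs G root" for z
      using that dep_par[of z] par_in_verts[of z] dep_eq_0_iff by (simp add: nbrs_root_iff)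
    then show ?thesis
      using par_ancs x y rW by (auto simp: W_def P_def)
  qed
  interpret C: tree_graph "bfs_tree W"
    using Wv parW rW by (rule tree_graph_bfs_tree)
  have xyW: "x \<in> W" "y \<in> W"
    using self_in_ancs by (auto simp: W_def P_def)
  obtain p where p: "C.awalk x p root" "length p = s" "set (C.awalk_verts x p) = ancs x"
    using bfs_tree_walk_to_root[OF Wv parW xyW(1)] x by metis
  obtain q' where q': "C.awalk y q' root" "length q' = t" "set (C.awalk_verts y q') = ancs y"
    using bfs_tree_walk_to_root[OF Wv parW xyW(2)] y by metis
  obtain q where q: "C.awalk root q y" "length q = t" "set (C.awalk_verts root q) = ancs y"
    using C.awalk_reverse[OF q'(1)] q' by metis
  have pq: "C.awalk x (p @ q) y" "set (C.awalk_verts x (p @ q)) = P"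
    using C.awalk_appendI[OF p(1) q(1)] C.set_awalk_verts_append[OF p(1) q(1)] p q
    by (simp_all add: P_def)
  \<comment> \<open>The walk visits \<open>Suc l\<close> distinct vertices and lists as many, so
    none is repeated and it is a path.\<close>
  moreover have "length (C.awalk_verts x (p @ q)) = Suc l"
    using p q st by (simp add: C.length_awalk_verts)
  ultimately have "C.apath x (p @ q) y"
    unfolding C.apath_def using cardP by (simp add: card_distinct del: C.awalk_append_iff)
  moreover have "length (p @ q) = (n - 1) - k + 1"
    using p q st l by simp
  moreover have "root \<in> set (C.awalk_verts x (p @ q))"
    using pq disj by (auto simp: P_def)
  moreover have degC: "out_degree (bfs_tree W) root = k" "max_degree (bfs_tree W) = k"
    using max_degree_bfs_tree[OF Wv rW _ deg(1)] by (simp_all add: W_def k_def)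
  ultimately have "comet_center (n - 1) k (bfs_tree W) root"
    unfolding comet_center_def verts_bfs_tree using rW by blast
  moreover have "tree_order_maxdeg (n - 1) k (bfs_tree W)"
    unfolding tree_order_maxdeg_def undirected_tree_iff
    using C.tree_graph_axioms cardW degC by simp
  ultimately have comet: "comet (n - 1) k (bfs_tree W)"
    unfolding comet_def using l by auto
  have "tree_graph (bfs_tree (verts G))"
    using par_in_verts by (intro tree_graph_bfs_tree) auto
  then have "tree_order_maxdeg n k (bfs_tree (verts G))"
    unfolding tree_order_maxdeg_def undirected_tree_iff
    using max_degree_bfs_tree[of "verts G"] nbrs_subset deg by (simp add: n_def k_def)
  then show ?thesis
    unfolding comet_star_def using comet subgraph_bfs_tree[OF Wv order.refl]
    by (auto simp: n_def k_def)
qed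

end

subsection \<open>Radius bounds\<close>

text \<open>Paths in trees are geodesics, so the ends of the path in the comet are
  \<open>n - k + 1\<close> apart, while no distance exceeds twice the radius.\<close>

lemma rad_short_comet_ge:
  assumes "short_comet n k S"
  shows "(n + 2 - k) div 2 \<le> rad S"
proof -
  interpret tree_graph S
    using assms by (auto simp: short_comet_def tree_order_maxdeg_def undirected_tree_iff)
  obtain a p b where p: "apath a p b" "length p = n - k + 1"
    using assms by (auto simp: short_comet_def comet_center_def)
  then have "a \<in> verts S" "b \<in> verts S"
    by (auto simp: apath_def)
  then have "n - k + 1 \<le> 2 * rad S"
    using gdist_le_two_rad gdist_apath[OF p(1)] p by metis
  then show ?thesis
    by linarith
qed

theorem theorem5:
  fixes G :: "('a,'b) pre_digraph" and n k :: nat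
  assumes "graph G" and "connected G"
    and "card (verts G) = n" and "max_degree G = k"
  shows "(\<forall>B :: ('c,'d) pre_digraph. balanced_tree n k B \<longrightarrow> rad B \<le> rad G) \<and>
    (\<forall>S :: ('e,'f) pre_digraph. short_comet n k S \<longrightarrow> rad G \<le> rad S) \<and>
    ((\<exists>H. subgraph H G \<and> balanced_tree n k H) \<longrightarrow>
      (\<forall>B :: ('c,'d) pre_digraph. balanced_tree n k B \<longrightarrow> rad G = rad B)) \<and>
    (\<forall>S :: ('e,'f) pre_digraph. short_comet n k S \<and> k + 2 \<le> n \<and> rad G = rad S \<longrightarrow>
      (\<exists>C. subgraph C G \<and> comet_star n k C))"
proof -
  interpret connected_graph G
    using assms by (simp add: connected_graph_def connected_graph_axioms_def)
  note n = assms(3) and k = assms(4)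
  have "max_degree G \<in> out_degree G ` verts G"
    unfolding max_degree_def using verts_nonempty by (intro Max_in) auto
  then obtain v where v: "v \<in> verts G" "out_degree G v = k"
    using k by auto
  interpret rooted_graph G v
    using v by unfold_locales
  have lower: "rad B \<le> rad G" if "balanced_tree n k B" for B :: "('c,'d) pre_digraph"
    using rad_ge_balanced_tree connected_graph_axioms that n k by metis
  have upper: "rad G \<le> rad S" if S: "short_comet n k S" for S :: "('e,'f) pre_digraph"
  proof -
    have "2 \<le> k"
      using S by (simp add: short_comet_def)
    then show ?thesis
      using rad_le rad_short_comet_ge[OF S] v n by simp
  qed
  have "rad G = rad B" if H: "subgraph H G" "balanced_tree n k H" and B: "balanced_tree n k B"
    for H and B :: "('c,'d) pre_digraph"
  proof (rule antisym)
    interpret H: tree_graph H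
      using H(2) by (auto simp: balanced_tree_def tree_order_maxdeg_def undirected_tree_iff)
    interpret B: tree_graph B
      using B by (auto simp: balanced_tree_def tree_order_maxdeg_def undirected_tree_iff)
    have "verts H = verts G"
      using H n by (intro card_subset_eq)
        (auto simp: balanced_tree_def tree_order_maxdeg_def)
    then have "rad G \<le> rad H"
      using H.connected_graph_axioms H(1) by (intro rad_spanning_le)
    \<comment> \<open>The lower bound is applied with \<open>B\<close> in the role of the graph and
      \<open>H\<close> as the balanced tree.\<close>
    also have "rad H \<le> rad B"
      using rad_ge_balanced_tree[OF B.connected_graph_axioms] H(2) B
      by (simp add: balanced_tree_def tree_order_maxdeg_def)
    finally show "rad G \<le> rad B" .
    show "rad B \<le> rad G"
      using B by (rule lower)
  qed
  moreover have "\<exists>C. subgraph C G \<and> comet_star n k C"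
    if S: "short_comet n k S" "k + 2 \<le> n" "rad G = rad S" for S :: "('e,'f) pre_digraph"
  proof -
    have "2 \<le> k"
      using S by (simp add: short_comet_def)
    then have "comet_star n k (bfs_tree (verts G))"
      using contains_comet_star rad_short_comet_ge[OF S(1)] S v n k by simp
    then show ?thesis
      using subgraph_bfs_tree_graph by blast
  qed
  ultimately show ?thesis
    using lower upper by blast
qed

end
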